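(* Let $G$ be a $k$-regular graph on $n$ vertices and let $\tau$ be the smallest eigenvalue of (the adjacency matrix of) $G$. For any subset $S$ of vertices of $G$, $$\mathscr{E}(S)\geq\frac{|S|^2}{2n}(k-\tau)+\frac{|S|\tau}{2},$$ where $\mathscr{E}(S)$ denotes the number of edges in the subgraph of $G$ induced by $S$.
   Context: Graphs are finite and simple. *)

theory Defs
  imports Complex_Main "Jordan_Normal_Form.Char_Poly"
begin

text \<open>A finite simple graph has a finite vertex set \<open>V\<close> and a set \<open>E\<close> of edges,
  each edge being an unordered pair of distinct vertices.\<close>

definition simple_graph :: "'a set \<Rightarrow> 'a set set \<Rightarrow> bool" where
  "simple_graph V E \<longleftrightarrow> finite V \<and> (\<forall>e\<in>E. e \<subseteq> V \<and> card e = 2)"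

definition vertex_degree :: "'a set set \<Rightarrow> 'a \<Rightarrow> nat" where
  "vertex_degree E v = card {e \<in> E. v \<in> e}"

definition regular_graph :: "nat \<Rightarrow> 'a set \<Rightarrow> 'a set set \<Rightarrow> bool" where
  "regular_graph k V E \<longleftrightarrow> simple_graph V E \<and> (\<forall>v\<in>V. vertex_degree E v = k)"

definition induced_edges :: "'a set set \<Rightarrow> 'a set \<Rightarrow> 'a set set" where
  "induced_edges E S = {e \<in> E. e \<subseteq> S}"

text \<open>Rows and columns of the adjacency matrix are indexed along an enumeration \<open>vs\<close>
  of the vertex set (without repetition). Diagonal entries are \<open>0\<close> in a simple graph,
  since \<open>{v, v}\<close> has only one element.\<close>

definition adjacency_matrix :: "'a list \<Rightarrow> 'a set set \<Rightarrow> real mat" where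
  "adjacency_matrix vs E =
     mat (length vs) (length vs) (\<lambda>(i, j). if {vs ! i, vs ! j} \<in> E then 1 else 0)"

text \<open>The adjacency matrix is real symmetric, so all its complex eigenvalues are real
  and it suffices to compare with the real ones. The \<open>0 \<times> 0\<close> matrix has no eigenvalue.\<close>

definition smallest_eigenvalue :: "real mat \<Rightarrow> real \<Rightarrow> bool" where
  "smallest_eigenvalue A \<tau> \<longleftrightarrow> eigenvalue A \<tau> \<and> (\<forall>\<mu>. eigenvalue A \<mu> \<longrightarrow> \<tau> \<le> \<mu>)"

end

theory Submission
  imports Defs
begin

text \<open>
  Put \<open>s = |S|\<close> and let \<open>x\<close> be the characteristic vector of \<open>S\<close> minus the constant
  \<open>s / n\<close>, which is the projection of that vector onto the complement of the all-ones
  eigenvector. Then \<open>x \<bullet> x = s - s\<^sup>2 / n\<close> and, by regularity, \<open>x \<bullet> A x = 2 e(S) - k s\<^sup>2 / n\<close>,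
  so the claim is the Rayleigh bound \<open>\<tau> (x \<bullet> x) \<le> x \<bullet> A x\<close>.

  The Rayleigh bound is obtained without compactness. Let \<open>m\<close> be the largest \<open>t\<close> for which
  \<open>A - t I\<close> is positive semidefinite. A positive semidefinite invertible matrix is bounded
  below by a positive multiple of the identity, so by maximality \<open>A - m I\<close> is singular
  and \<open>m\<close> is an eigenvalue.
\<close>

section \<open>Rayleigh quotients of real symmetric matrices\<close>

lemma real_scalar_prod_self_ge_0: "(x :: real vec) \<bullet> x \<ge> 0"
  by (simp add: scalar_prod_def sum_nonneg)

lemma real_scalar_prod_self_pos:
  assumes "x \<in> carrier_vec n" and "x \<noteq> 0\<^sub>v n"
  shows "(x :: real vec) \<bullet> x > 0"
proof -
  from assms obtain i where i: "i < n" "x $ i \<noteq> 0"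
    by (metis carrier_vecD eq_vecI index_zero_vec)
  have "0 < x $ i * x $ i" using i(2) by (metis not_real_square_gt_zero)
  also have "\<dots> \<le> (\<Sum>j\<in>{0..<dim_vec x}. x $ j * x $ j)"
    using i assms(1) by (intro member_le_sum) auto
  finally show ?thesis by (simp add: scalar_prod_def)
qed

lemma scalar_prod_mult_mat_vec_sum:
  assumes "A \<in> carrier_mat n n" and "x \<in> carrier_vec n"
  shows "x \<bullet> (A *\<^sub>v x) = (\<Sum>i<n. \<Sum>j<n. A $$ (i, j) * (x $ i * x $ j :: 'a :: comm_semiring_0))"
proof -
  have "x \<bullet> (A *\<^sub>v x) = (\<Sum>i\<in>{0..<n}. x $ i * (\<Sum>j\<in>{0..<n}. A $$ (i, j) * x $ j))"
    using assms by (simp add: scalar_prod_def)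
  then show ?thesis
    by (simp add: sum_distrib_left atLeast0LessThan ac_simps)
qed

text \<open>By the AM-GM inequality every product \<open>x $ i * x $ j\<close> is at most
  \<open>x \<bullet> x\<close> in absolute value, so the entries of \<open>A\<close> can be bounded
  one by one.\<close>

lemma quadratic_form_bound:
  fixes A :: "real mat"
  assumes A: "A \<in> carrier_mat n n"
  obtains C where "C > 0"
    and "\<And>x. x \<in> carrier_vec n \<Longrightarrow> \<bar>x \<bullet> (A *\<^sub>v x)\<bar> \<le> C * (x \<bullet> x)"
proof
  \<comment> \<open>The summand 1 keeps the constant positive even for the zero matrix, so that
    \<open>1 / C\<close> can be formed later.\<close>
  let ?C = "(\<Sum>i<n. \<Sum>j<n. \<bar>A $$ (i, j)\<bar>) + 1"
  show "?C > 0" by (simp add: add_nonneg_pos sum_nonneg)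
  fix x :: "real vec" assume x: "x \<in> carrier_vec n"
  have sq: "x $ i * x $ i \<le> x \<bullet> x" if "i < n" for i
    unfolding scalar_prod_def using that x by (intro member_le_sum) auto
  have prod: "\<bar>x $ i * x $ j\<bar> \<le> x \<bullet> x" if "i < n" "j < n" for i j
  proof -
    have "0 \<le> (\<bar>x $ i\<bar> - \<bar>x $ j\<bar>)\<^sup>2" by simp
    then have "2 * \<bar>x $ i * x $ j\<bar> \<le> x $ i * x $ i + x $ j * x $ j"
      by (simp add: power2_diff abs_mult mult.assoc flip: power2_eq_square)
    with sq[OF that(1)] sq[OF that(2)] show ?thesis by linarith
  qed
  have "\<bar>x \<bullet> (A *\<^sub>v x)\<bar> \<le> (\<Sum>i<n. \<Sum>j<n. \<bar>A $$ (i, j) * (x $ i * x $ j)\<bar>)"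
    unfolding scalar_prod_mult_mat_vec_sum[OF A x]
    by (intro order_trans[OF sum_abs] sum_mono) auto
  also have "\<dots> \<le> (\<Sum>i<n. \<Sum>j<n. \<bar>A $$ (i, j)\<bar> * (x \<bullet> x))"
    unfolding abs_mult[of "A $$ _"] by (intro sum_mono mult_left_mono prod) auto
  also have "\<dots> \<le> ?C * (x \<bullet> x)"
    by (simp add: sum_distrib_right distrib_right real_scalar_prod_self_ge_0)
  finally show "\<bar>x \<bullet> (A *\<^sub>v x)\<bar> \<le> ?C * (x \<bullet> x)" .
qed

lemma symmetric_mat_scalar_prod_commute:
  fixes A :: "'a :: comm_semiring_0 mat"
  assumes "A \<in> carrier_mat n n" and "A\<^sup>T = A" and "x \<in> carrier_vec n" and "y \<in> carrier_vec n"
  shows "x \<bullet> (A *\<^sub>v y) = y \<bullet> (A *\<^sub>v x)"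
  using transpose_vec_mult_scalar[OF assms(1,4,3)] assms comm_scalar_prod[of _ n]
  by (metis mult_mat_vec_carrier)

text \<open>Cauchy-Schwarz for the form of \<open>B\<close>, applied to \<open>x\<close> and
  \<open>y\<close>, the preimage of \<open>x\<close> under \<open>B\<close>, bounds the square of
  \<open>x \<bullet> x\<close> by \<open>(x \<bullet> (B *\<^sub>v x)) * (x \<bullet> y)\<close>.
  Since \<open>x \<bullet> y\<close> is at most \<open>C * (x \<bullet> x)\<close>, the constant
  \<open>1 / C\<close> works.\<close>

lemma psd_invertible_coercive:
  fixes B :: "real mat"
  assumes B: "B \<in> carrier_mat n n" and sym: "B\<^sup>T = B"
    and psd: "\<And>x. x \<in> carrier_vec n \<Longrightarrow> 0 \<le> x \<bullet> (B *\<^sub>v x)"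
    and det: "det B \<noteq> 0"
  obtains c where "c > 0"
    and "\<And>x. x \<in> carrier_vec n \<Longrightarrow> c * (x \<bullet> x) \<le> x \<bullet> (B *\<^sub>v x)"
proof -
  from det_non_zero_imp_unit[OF B det, of "()"] obtain D
    where D: "D \<in> carrier_mat n n" and BD: "B * D = 1\<^sub>m n"
    unfolding Units_def ring_mat_simps by auto
  obtain C where C: "C > 0"
    "\<And>x. x \<in> carrier_vec n \<Longrightarrow> \<bar>x \<bullet> (D *\<^sub>v x)\<bar> \<le> C * (x \<bullet> x)"
    using quadratic_form_bound[OF D] by blast
  show thesis
  proof
    show "1 / C > 0" using C(1) by simp
    fix x :: "real vec" assume x: "x \<in> carrier_vec n"
    define y where "y = D *\<^sub>v x"
    define t where "t = - 1 / C"
    have y: "y \<in> carrier_vec n" using D x by (simp add: y_def)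
    have By: "B *\<^sub>v y = x"
      unfolding y_def using B D x BD assoc_mult_mat_vec[OF B D x] by simp
    have Bx: "B *\<^sub>v x \<in> carrier_vec n" using B x by simp
    have yBx: "y \<bullet> (B *\<^sub>v x) = x \<bullet> x"
      using symmetric_mat_scalar_prod_commute[OF B sym x y] By by simp
    have xy: "x \<bullet> y \<le> C * (x \<bullet> x)" using C(2)[OF x] by (simp add: y_def)
    \<comment> \<open>Expanding the form at \<open>x + t B\<^sup>-\<^sup>1 x\<close> is the Cauchy--Schwarz inequality for \<open>B\<close>;
      \<open>t\<close> is the minimiser once \<open>x \<bullet> B\<^sup>-\<^sup>1 x\<close> is replaced by its bound \<open>C (x \<bullet> x)\<close>.\<close>
    have "B *\<^sub>v (x + t \<cdot>\<^sub>v y) = B *\<^sub>v x + t \<cdot>\<^sub>v x"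
      using B x y By by (simp add: mult_add_distrib_mat_vec[OF B] mult_mat_vec[OF B])
    then have "0 \<le> (x + t \<cdot>\<^sub>v y) \<bullet> (B *\<^sub>v x + t \<cdot>\<^sub>v x)"
      using psd[of "x + t \<cdot>\<^sub>v y"] x y by simp
    also have "\<dots> = x \<bullet> (B *\<^sub>v x) + 2 * t * (x \<bullet> x) + t\<^sup>2 * (x \<bullet> y)"
      using x y Bx yBx comm_scalar_prod[OF y x]
      by (simp add: add_scalar_prod_distrib[of _ n] scalar_prod_add_distrib[of _ n]
          power2_eq_square algebra_simps)
    also have "\<dots> \<le> x \<bullet> (B *\<^sub>v x) + 2 * t * (x \<bullet> x) + t\<^sup>2 * (C * (x \<bullet> x))"
      using xy by (simp add: mult_left_mono)
    also have "\<dots> = x \<bullet> (B *\<^sub>v x) - 1 / C * (x \<bullet> x)"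
      using C(1) by (simp add: t_def power2_eq_square field_simps)
    finally show "1 / C * (x \<bullet> x) \<le> x \<bullet> (B *\<^sub>v x)" by simp
  qed
qed

text \<open>As \<open>char_matrix A t\<close> is \<open>A\<close> minus \<open>t\<close> times the
  identity, over the reals its form is nonnegative exactly when \<open>t\<close> bounds the Rayleigh
  quotients of \<open>A\<close> from below.\<close>

lemma scalar_prod_char_matrix:
  fixes A :: "'a :: field mat"
  assumes A: "A \<in> carrier_mat n n" and x: "x \<in> carrier_vec n"
  shows "x \<bullet> (char_matrix A t *\<^sub>v x) = x \<bullet> (A *\<^sub>v x) - t * (x \<bullet> x)"
proof -
  have "(- t \<cdot>\<^sub>m 1\<^sub>m n) *\<^sub>v x = - t \<cdot>\<^sub>v x" using x by (intro eq_vecI) auto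
  then have "char_matrix A t *\<^sub>v x = A *\<^sub>v x + - t \<cdot>\<^sub>v x"
    unfolding char_matrix_def using A x by (simp add: add_mult_distrib_mat_vec[OF A])
  then show ?thesis using A x
    by (simp add: scalar_prod_add_distrib[of _ n])
qed

lemma transpose_char_matrix:
  assumes "A \<in> carrier_mat n n" and "A\<^sup>T = A"
  shows "(char_matrix A t)\<^sup>T = char_matrix A t"
proof -
  have "A $$ (j, i) = A $$ (i, j)" if "i < n" "j < n" for i j
    using assms that by (metis carrier_matD index_transpose_mat(1))
  then show ?thesis using assms(1)
    by (intro eq_matI) (auto simp: char_matrix_def)
qed

theorem smallest_eigenvalue_le_quadratic_form:
  assumes A: "A \<in> carrier_mat n n" and sym: "A\<^sup>T = A"
    and \<tau>: "smallest_eigenvalue A \<tau>" and y: "y \<in> carrier_vec n"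
  shows "\<tau> * (y \<bullet> y) \<le> y \<bullet> (A *\<^sub>v y)"
proof -
  define T where "T = {t. \<forall>x\<in>carrier_vec n. t * (x \<bullet> x) \<le> x \<bullet> (A *\<^sub>v x)}"
  obtain C where C: "C > 0" "\<And>x. x \<in> carrier_vec n \<Longrightarrow> \<bar>x \<bullet> (A *\<^sub>v x)\<bar> \<le> C * (x \<bullet> x)"
    using quadratic_form_bound[OF A] by blast
  have ne: "T \<noteq> {}"
    using C(2) unfolding T_def by (auto intro!: exI[of _ "- C"] simp: abs_le_iff) force
  obtain v where v: "v \<in> carrier_vec n" "v \<noteq> 0\<^sub>v n" "A *\<^sub>v v = \<tau> \<cdot>\<^sub>v v"
    using \<tau> A unfolding smallest_eigenvalue_def eigenvalue_def eigenvector_def by auto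
  \<comment> \<open>The Rayleigh quotient at the eigenvector \<open>v\<close> is \<tau>, so \<tau>
    is an upper bound of \<open>T\<close>.\<close>
  have le: "t \<le> \<tau>" if "t \<in> T" for t
    using that v real_scalar_prod_self_pos[OF v(1,2)] unfolding T_def by force
  then have bdd: "bdd_above T" by (auto simp: bdd_above_def)
  define m where "m = Sup T"
  \<comment> \<open>The supremum is attained: each Rayleigh quotient is an upper bound of
    \<open>T\<close>, hence at least \<open>m\<close>.\<close>
  have mT: "m * (x \<bullet> x) \<le> x \<bullet> (A *\<^sub>v x)" if x: "x \<in> carrier_vec n" for x
  proof (cases "x = 0\<^sub>v n")
    case True
    then show ?thesis using A by simp
  next
    case False
    then have pos: "x \<bullet> x > 0" using x by (rule real_scalar_prod_self_pos[rotated])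
    have "m \<le> (x \<bullet> (A *\<^sub>v x)) / (x \<bullet> x)"
      unfolding m_def using ne x pos
      by (intro cSup_least) (auto simp: T_def pos_le_divide_eq)
    then show ?thesis using pos by (simp add: pos_le_divide_eq)
  qed
  have "eigenvalue A m"
  proof (rule ccontr)
    assume "\<not> eigenvalue A m"
    then have det: "det (char_matrix A m) \<noteq> 0" using eigenvalue_det[OF A] by simp
    have psd: "0 \<le> x \<bullet> (char_matrix A m *\<^sub>v x)" if "x \<in> carrier_vec n" for x
      using mT[OF that] scalar_prod_char_matrix[OF A that] by simp
    obtain c where c: "c > 0"
      "\<And>x. x \<in> carrier_vec n \<Longrightarrow> c * (x \<bullet> x) \<le> x \<bullet> (char_matrix A m *\<^sub>v x)"
      using psd_invertible_coercive[OF char_matrix_closed[OF A] transpose_char_matrix[OF A sym] psd det]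
      by blast
    \<comment> \<open>Coercivity leaves room to raise \<open>m\<close> by \<open>c\<close>, against
      its maximality.\<close>
    have "m + c \<in> T"
      using c(2) by (auto simp: T_def scalar_prod_char_matrix[OF A] algebra_simps)
    then have "m + c \<le> m" unfolding m_def using bdd by (rule cSup_upper)
    with c(1) show False by simp
  qed
  then have "\<tau> \<le> m" using \<tau> by (simp add: smallest_eigenvalue_def)
  then have "\<tau> * (y \<bullet> y) \<le> m * (y \<bullet> y)"
    by (simp add: mult_right_mono real_scalar_prod_self_ge_0)
  with mT[OF y] show ?thesis by simp
qed

section \<open>Counting edges\<close>

lemma simple_graph_finite_edges:
  assumes "simple_graph V E"
  shows "finite E"
  using assms finite_subset[of E "Pow V"] by (auto simp: simple_graph_def)

lemma simple_graph_induced: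
  assumes "simple_graph V E" and "S \<subseteq> V"
  shows "simple_graph S (induced_edges E S)"
  using assms by (auto simp: simple_graph_def induced_edges_def intro: finite_subset)

text \<open>The neighbours \<open>v\<close> of \<open>u\<close> correspond to the edges at
  \<open>u\<close> through \<open>{u, v}\<close>.\<close>

lemma sum_adjacency_eq_degree:
  assumes G: "simple_graph V E" and u: "u \<in> V"
  shows "(\<Sum>v\<in>V. of_bool ({u, v} \<in> E) :: real) = real (vertex_degree E u)"
proof -
  have "bij_betw (\<lambda>v. {u, v}) {v \<in> V. {u, v} \<in> E} {e \<in> E. u \<in> e}"
  proof (rule bij_betwI')
    fix e assume e: "e \<in> {e \<in> E. u \<in> e}"
    then have "e \<subseteq> V" "card e = 2" using G by (auto simp: simple_graph_def)
    with e show "\<exists>v\<in>{v \<in> V. {u, v} \<in> E}. e = {u, v}"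
      by (auto simp: card_2_iff insert_commute)
  qed (auto simp: doubleton_eq_iff)
  then have "card {v \<in> V. {u, v} \<in> E} = vertex_degree E u"
    unfolding vertex_degree_def by (rule bij_betw_same_card)
  moreover have "finite V" using G by (simp add: simple_graph_def)
  ultimately show ?thesis by (simp add: Int_def)
qed

text \<open>Handshake lemma, by double counting of incidences between vertices and edges.\<close>

lemma sum_vertex_degree:
  assumes G: "simple_graph V E"
  shows "(\<Sum>v\<in>V. vertex_degree E v) = 2 * card E"
  unfolding vertex_degree_def
proof (rule sum_multicount)
  show "\<forall>e\<in>E. card {v \<in> V. v \<in> e} = 2"
  proof
    fix e assume "e \<in> E"
    then have "e \<subseteq> V" "card e = 2" using G by (auto simp: simple_graph_def)
    then show "card {v \<in> V. v \<in> e} = 2"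
      by (metis (no_types, lifting) Collect_mem_eq Collect_cong subsetD)
  qed
qed (use G simple_graph_finite_edges in \<open>auto simp: simple_graph_def\<close>)

lemma sum_adjacency_induced:
  assumes G: "simple_graph V E" and S: "S \<subseteq> V"
  shows "(\<Sum>u\<in>S. \<Sum>v\<in>S. of_bool ({u, v} \<in> E)) = 2 * real (card (induced_edges E S))"
proof -
  note H = simple_graph_induced[OF G S]
  have "(\<Sum>v\<in>S. of_bool ({u, v} \<in> E)) = real (vertex_degree (induced_edges E S) u)"
    if "u \<in> S" for u
    unfolding sum_adjacency_eq_degree[OF H that, symmetric]
    using that by (intro sum.cong) (auto simp: induced_edges_def)
  then have "(\<Sum>u\<in>S. \<Sum>v\<in>S. of_bool ({u, v} \<in> E))
      = (\<Sum>u\<in>S. real (vertex_degree (induced_edges E S) u))"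
    by (intro sum.cong) auto
  also have "\<dots> = real (\<Sum>u\<in>S. vertex_degree (induced_edges E S) u)" by simp
  finally show ?thesis by (simp only: sum_vertex_degree[OF H])
qed

text \<open>Here \<open>f\<close> is the indicator of \<open>S\<close> minus its mean
  \<open>c\<close>. Expanding the form gives twice the number of induced edges, minus
  \<open>2 * c * k * card S\<close>, plus \<open>c * c * k * card V\<close>; the relation between
  \<open>c\<close> and \<open>card S\<close> merges the last two terms.\<close>

lemma regular_quadratic_form:
  fixes c :: real
  assumes reg: "regular_graph k V E" and S: "S \<subseteq> V"
    and c: "c * real (card V) = real (card S)"
  defines "f \<equiv> \<lambda>v. of_bool (v \<in> S) - c"
  shows "(\<Sum>u\<in>V. \<Sum>v\<in>V. of_bool ({u, v} \<in> E) * (f u * f v))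
    = 2 * real (card (induced_edges E S)) - c * real k * real (card S)"
proof -
  have G: "simple_graph V E" and fin: "finite V"
    using reg by (auto simp: regular_graph_def simple_graph_def)
  have deg: "(\<Sum>v\<in>V. of_bool ({u, v} \<in> E)) = real k" if "u \<in> V" for u
    using sum_adjacency_eq_degree[OF G that] reg that by (simp add: regular_graph_def)
  \<comment> \<open>For a vertex \<open>u\<close>, this counts its neighbours in
    \<open>S\<close>.\<close>
  define g where "g u = (\<Sum>v\<in>S. of_bool ({u, v} \<in> E) :: real)" for u
  have restrict: "(\<Sum>v\<in>V. h v * of_bool (v \<in> S)) = sum h S" for h :: "'a \<Rightarrow> real"
    using S fin by (simp add: of_bool_def if_distrib sum.If_cases Int_absorb1 cong: if_cong)
  have inner: "(\<Sum>v\<in>V. of_bool ({u, v} \<in> E) * f v) = g u - c * real k" if "u \<in> V" for u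
    unfolding f_def right_diff_distrib sum_subtractf restrict
    using deg[OF that] by (simp add: g_def flip: sum_distrib_right)
  have "(\<Sum>u\<in>V. \<Sum>v\<in>V. of_bool ({u, v} \<in> E) * (f u * f v))
      = (\<Sum>u\<in>V. f u * (\<Sum>v\<in>V. of_bool ({u, v} \<in> E) * f v))"
    by (simp add: sum_distrib_left ac_simps)
  also have "\<dots> = (\<Sum>u\<in>V. (g u - c * real k) * of_bool (u \<in> S) - c * (g u - c * real k))"
    by (intro sum.cong refl) (simp only: inner, simp add: f_def algebra_simps)
  also have "\<dots> = sum g S - c * real k * real (card S) - c * (sum g V - real (card V) * (c * real k))"
    unfolding sum_subtractf restrict by (simp add: sum_subtractf flip: sum_distrib_left)
  \<comment> \<open>After swapping the sums each vertex of \<open>S\<close> contributes its degree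
    \<open>k\<close>, so the bracket multiplied by \<open>c\<close> vanishes.\<close>
  also have "sum g V = (\<Sum>v\<in>S. \<Sum>u\<in>V. of_bool ({v, u} \<in> E))"
    unfolding g_def by (subst sum.swap) (simp add: insert_commute)
  also have "\<dots> = real (card V) * (c * real k)"
    using S deg by (subst sum.cong[OF refl deg]) (auto simp flip: c)
  also have "sum g S = 2 * real (card (induced_edges E S))"
    unfolding g_def by (rule sum_adjacency_induced[OF G S])
  finally show ?thesis by simp
qed

section \<open>From sums over vertices to the adjacency matrix\<close>

lemma transpose_adjacency_matrix: "(adjacency_matrix vs E)\<^sup>T = adjacency_matrix vs E"
  by (rule eq_matI) (auto simp: adjacency_matrix_def insert_commute)

lemma sum_nth_distinct:
  assumes "distinct xs"
  shows "(\<Sum>i<length xs. f (xs ! i)) = sum f (set xs)"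
  using sum.reindex_bij_betw[OF bij_betw_nth[OF assms refl refl]] .

theorem proposition1p6:
  fixes V :: "'a set" and E :: "'a set set" and vs :: "'a list"
    and k n :: nat and \<tau> :: real and S :: "'a set"
  assumes "regular_graph k V E"
    and "card V = n"
    and "distinct vs" and "set vs = V"
    and "smallest_eigenvalue (adjacency_matrix vs E) \<tau>"
    and "S \<subseteq> V"
  shows "real (card (induced_edges E S)) \<ge>
    (real (card S))\<^sup>2 / (2 * real n) * (real k - \<tau>) + real (card S) * \<tau> / 2"
proof (cases "n = 0")
  case True
  then have "S = {}" using assms by auto
  then show ?thesis by simp
next
  case False
  define s where "s = real (card S)"
  define c where "c = s / real n"
  define f where "f v = of_bool (v \<in> S) - c" for v
  define x where "x = vec n (\<lambda>i. f (vs ! i))"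
  let ?A = "adjacency_matrix vs E"
  have len: "length vs = n" using assms distinct_card by fastforce
  have A: "?A \<in> carrier_mat n n" and x: "x \<in> carrier_vec n"
    by (simp_all add: adjacency_matrix_def x_def len)
  have c: "c * real n = s" using False by (simp add: c_def)
  note nth_sum = sum_nth_distinct[OF assms(3), unfolded len assms(4)]
  have fin: "finite V" using assms(4) by auto
  have "x \<bullet> x = (\<Sum>i<n. f (vs ! i) * f (vs ! i))"
    by (simp add: scalar_prod_def x_def atLeast0LessThan)
  also have "\<dots> = (\<Sum>v\<in>V. f v * f v)" by (rule nth_sum)
  \<comment> \<open>The indicator of \<open>S\<close> is its own square, so the square of
    \<open>f\<close> is affine in it.\<close>
  also have "\<dots> = (\<Sum>v\<in>V. (1 - 2 * c) * of_bool (v \<in> S) + c * c)"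
    by (intro sum.cong) (auto simp: f_def algebra_simps)
  also have "\<dots> = (1 - 2 * c) * s + real n * (c * c)"
    using fin assms(2,6)
    by (simp add: sum.distrib s_def Int_absorb1 flip: sum_distrib_left)
  also have "\<dots> = s - c * s" by (simp add: algebra_simps flip: c)
  finally have xx: "x \<bullet> x = s - c * s" .
  have "x \<bullet> (?A *\<^sub>v x)
      = (\<Sum>i<n. \<Sum>j<n. of_bool ({vs ! i, vs ! j} \<in> E) * (f (vs ! i) * f (vs ! j)))"
    unfolding scalar_prod_mult_mat_vec_sum[OF A x]
    by (intro sum.cong refl) (auto simp: adjacency_matrix_def x_def len)
  also have "\<dots> = (\<Sum>i<n. \<Sum>v\<in>V. of_bool ({vs ! i, v} \<in> E) * (f (vs ! i) * f v))"
    by (intro sum.cong refl) (rule nth_sum)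
  also have "\<dots> = (\<Sum>u\<in>V. \<Sum>v\<in>V. of_bool ({u, v} \<in> E) * (f u * f v))"
    by (rule nth_sum)
  also have "\<dots> = 2 * real (card (induced_edges E S)) - c * real k * s"
    using regular_quadratic_form[OF assms(1,6), of c] c assms(2) by (simp add: f_def s_def)
  finally have "\<tau> * (s - c * s) \<le> 2 * real (card (induced_edges E S)) - c * real k * s"
    using smallest_eigenvalue_le_quadratic_form[OF A transpose_adjacency_matrix assms(5) x] xx
    by simp
  \<comment> \<open>This turns half of the Rayleigh bound into the claimed form.\<close>
  moreover have "s\<^sup>2 / (2 * real n) = c * s / 2" by (simp add: c_def power2_eq_square)
  ultimately show ?thesis
    unfolding s_def[symmetric] by (simp only:) (simp add: field_simps)
qed

end
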